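(* Let $\mathbb{H}^2=\{z\in\mathbb{C}: |z|<1\}$ be the hyperbolic disc with its Riemannian metric $\frac{4}{(1-(x^2+y^2))^2}(dx^2+dy^2)$, $z=x+iy$, of constant curvature $-1$, and equip $\mathbb{H}^2\times\mathbb{R}$ with the product metric. Let the functions $f,g:\mathbb{H}^2\to\mathbb{C}$ be holomorphic and let $p:\mathbb{R}\to\mathbb{R}$ be a polynomial $p(t)=b_0+b_1t+b_2t^2+b_3t^3$ such that $(b_2,b_3)\neq 0$. Then the function $$F(z,t)=(f(z)+g(\bar z))\cdot p(t)$$ is proper biharmonic on the product space $\mathbb{H}^2\times\mathbb{R}$.
   Context: For a Riemannian manifold $(M,g)$, $\tau=\operatorname{div}\nabla$ denotes the Laplace-Beltrami operator acting on smooth complex-valued functions (the metric being extended complex-bilinearly), and $\tau^2(f)=\tau(\tau(f))$. A function $f:(M,g)\to\mathbb{C}$ is proper biharmonic if $\tau^2(f)=0$ and $\tau(f)$ does not vanish identically. On $\mathbb{H}^2\times\mathbb{R}$ the operator is $\tau(f)=4(1-z\bar z)^2\frac{\partial^2 f}{\partial z\partial\bar z}+\frac{\partial^2 f}{\partial t^2}$.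
   Formalization: Assumes f(z)+g(z̄) is not identically zero on the disc (otherwise F = 0, which is not proper biharmonic); τ is div∇ of the stated metric, so its z-part is (1−z z̄)²∂²/∂z∂z̄, without the factor 4 displayed in the source. *)

theory Defs
  imports "HOL-Analysis.Analysis"
begin

section \<open>Smooth functions\<close>

primrec Ck_on :: "nat \<Rightarrow> ('a::euclidean_space \<Rightarrow> 'b::real_normed_vector) \<Rightarrow> 'a set \<Rightarrow> bool" where
  "Ck_on 0 f S \<longleftrightarrow> continuous_on S f"
| "Ck_on (Suc k) f S \<longleftrightarrow> (\<forall>x\<in>S. f differentiable (at x)) \<and>
     (\<forall>v. Ck_on k (\<lambda>x. frechet_derivative f (at x) v) S)"

text \<open>Intended for open \<^term>\<open>S\<close>.\<close>
definition smooth_on :: "('a::euclidean_space \<Rightarrow> 'b::real_normed_vector) \<Rightarrow> 'a set \<Rightarrow> bool" where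
  "smooth_on f S \<longleftrightarrow> (\<forall>k. Ck_on k f S)"


section \<open>The Laplace-Beltrami operator in a global chart\<close>

text \<open>The manifold is an open subset of a Euclidean space \<^typ>\<open>'a\<close>, so that every tangent space is
  \<^typ>\<open>'a\<close>, and a Riemannian metric assigns to each point a bilinear form. The vector
  \<^term>\<open>E :: 'a ^ 'n\<close> lists the coordinate directions; it has to be a basis of \<^typ>\<open>'a\<close>.
  Vector fields with complex coefficients (such as the gradient of a complex-valued
  function for the complex-bilinear extension of the metric) are given by their components with
  respect to \<^term>\<open>E\<close>.\<close>

type_synonym 'a metric = "'a \<Rightarrow> 'a \<Rightarrow> 'a \<Rightarrow> real"

definition partial :: "'a::euclidean_space ^ 'n \<Rightarrow> 'n \<Rightarrow> ('a \<Rightarrow> complex) \<Rightarrow> 'a \<Rightarrow> complex" where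
  "partial E i f p = frechet_derivative f (at p) (E $ i)"

definition gram :: "'a::euclidean_space ^ 'n \<Rightarrow> 'a metric \<Rightarrow> 'a \<Rightarrow> real ^ 'n ^ 'n" where
  "gram E g p = (\<chi> i j. g p (E $ i) (E $ j))"

definition gradient ::
  "'a::euclidean_space ^ 'n \<Rightarrow> 'a metric \<Rightarrow> ('a \<Rightarrow> complex) \<Rightarrow> 'a \<Rightarrow> complex ^ 'n" where
  "gradient E g f p =
     (\<chi> i. \<Sum>j\<in>UNIV. complex_of_real (matrix_inv (gram E g p) $ i $ j) * partial E j f p)"

definition divergence ::
  "'a::euclidean_space ^ 'n \<Rightarrow> 'a metric \<Rightarrow> ('a \<Rightarrow> complex ^ 'n) \<Rightarrow> 'a \<Rightarrow> complex" where
  "divergence E g X p =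
     (\<Sum>i\<in>UNIV. partial E i (\<lambda>q. complex_of_real (sqrt (det (gram E g q))) * X q $ i) p)
       / complex_of_real (sqrt (det (gram E g p)))"

definition laplace_beltrami ::
  "'a::euclidean_space ^ 'n \<Rightarrow> 'a metric \<Rightarrow> ('a \<Rightarrow> complex) \<Rightarrow> 'a \<Rightarrow> complex" where
  "laplace_beltrami E g f = divergence E g (gradient E g f)"

definition proper_biharmonic_on ::
  "'a::euclidean_space ^ 'n \<Rightarrow> 'a metric \<Rightarrow> 'a set \<Rightarrow> ('a \<Rightarrow> complex) \<Rightarrow> bool" where
  "proper_biharmonic_on E g M f \<longleftrightarrow>
     smooth_on f M \<and>
     (\<forall>p\<in>M. laplace_beltrami E g (laplace_beltrami E g f) p = 0) \<and>
     (\<exists>p\<in>M. laplace_beltrami E g f p \<noteq> 0)"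


section \<open>The product of the hyperbolic disc with the real line\<close>

definition product_metric :: "'a metric \<Rightarrow> 'b metric \<Rightarrow> ('a \<times> 'b) metric" where
  "product_metric g h p v w = g (fst p) (fst v) (fst w) + h (snd p) (snd v) (snd w)"

definition euclidean_metric :: "'a::euclidean_space metric" where
  "euclidean_metric p v w = v \<bullet> w"

definition hyperbolic_disc :: "complex set" where
  "hyperbolic_disc = {z. cmod z < 1}"

definition hyperbolic_metric :: "complex metric" where
  "hyperbolic_metric z v w = 4 / (1 - ((Re z)\<^sup>2 + (Im z)\<^sup>2))\<^sup>2 * (Re v * Re w + Im v * Im w)"

definition H2R :: "(complex \<times> real) set" where
  "H2R = hyperbolic_disc \<times> UNIV"

definition H2R_metric :: "(complex \<times> real) metric" where
  "H2R_metric = product_metric hyperbolic_metric euclidean_metric"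

text \<open>The coordinates are \<open>(x, y, t)\<close> with \<open>z = x + \<i> y\<close>. For the metric above, the operator
  \<open>div \<nabla>\<close> is \<open>(1 - z z\<^sup>*)\<^sup>2 \<partial>\<^sup>2/\<partial>z\<partial>z\<^sup>* + \<partial>\<^sup>2/\<partial>t\<^sup>2\<close>, where \<open>z\<^sup>*\<close> is the conjugate of \<open>z\<close>; an additional
  factor 4 in the first term belongs to the metric \<open>(dx\<^sup>2 + dy\<^sup>2) / (1 - x\<^sup>2 - y\<^sup>2)\<^sup>2\<close> of curvature -4.\<close>
definition H2R_frame :: "(complex \<times> real) ^ 3" where
  "H2R_frame = vector [(1, 0), (\<i>, 0), (0, 1)]"

end

theory Submission
  imports Defs "HOL-Complex_Analysis.Cauchy_Integral_Formula"
begin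

text \<open>In the coordinates \<open>(x, y, t)\<close> the metric is diagonal, with entries \<open>\<lambda>\<close>, \<open>\<lambda>\<close>, 1, where
  \<open>\<lambda> = 4 / (1 - \<bar>z\<bar>\<^sup>2)\<^sup>2\<close> is independent of \<open>t\<close>. The conformal factor cancels against the volume density in the
  two disc directions and commutes with \<open>\<partial>/\<partial>t\<close>, so that
  \<open>div \<nabla> F = (F\<^sub>x\<^sub>x + F\<^sub>y\<^sub>y) / \<lambda> + F\<^sub>t\<^sub>t\<close> (\<open>laplace_beltrami_H2R\<close>).

  A sum \<open>f(z) + g(z\<^sup>*)\<close> of a holomorphic and an antiholomorphic function is harmonic for the flat
  Laplacian, hence only the \<open>t\<close>-derivatives survive: the operator sends \<open>(f(z) + g(z\<^sup>*)) q(t)\<close> to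
  \<open>(f(z) + g(z\<^sup>*)) q''(t)\<close> (\<open>laplace_beltrami_separated\<close>). A function of the same form results, so
  the operator can be applied again, and a cubic has fourth derivative 0. Its second derivative
  \<open>2 b\<^sub>2 + 6 b\<^sub>3 t\<close> is not the zero polynomial when \<open>(b\<^sub>2, b\<^sub>3) \<noteq> 0\<close>. Since \<open>f(z) + g(z\<^sup>*)\<close> does
  not vanish identically, neither does the product of the two, which makes the function properly
  biharmonic.

  Smoothness uses the same closure property: a directional derivative of a function of this form is
  a sum of two functions of this form (\<open>has_derivative_separated\<close>), so that induction on the order of
  differentiability applies (\<open>Ck_on_separated\<close>).\<close>

section \<open>Derivatives on open sets\<close>

text \<open>The derivatives computed below have closed forms only on the open set under study, so a second
  differentiation has to be local. The congruence rules hold because functions that agree near a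
  point have the same candidates for a derivative there, so that the choice operator behind
  \<^const>\<open>frechet_derivative\<close> selects the same one.\<close>

lemma frechet_derivative_cong_open:
  assumes "open S" "x \<in> S" "\<And>y. y \<in> S \<Longrightarrow> f y = g y"
  shows "frechet_derivative f (at x) = frechet_derivative g (at x)"
proof -
  have "(f has_derivative D) (at x) \<longleftrightarrow> (g has_derivative D) (at x)" for D
    using assms by (metis (full_types) has_derivative_transform_within_open)
  then show ?thesis by (simp add: frechet_derivative_def)
qed

lemma Ck_on_cong:
  assumes "open S" "\<And>y. y \<in> S \<Longrightarrow> f y = g y" "Ck_on k f S"
  shows "Ck_on k g S"
  using assms(2,3)
proof (induction k arbitrary: f g)
  case 0
  then show ?case by (simp cong: continuous_on_cong)
next
  case (Suc k)
  have "g differentiable (at x)" if "x \<in> S" for x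
  proof -
    have "f differentiable (at x)" using Suc.prems(2) that by simp
    then obtain D where "(f has_derivative D) (at x)" unfolding differentiable_def ..
    then have "(g has_derivative D) (at x)"
      by (rule has_derivative_transform_within_open[OF _ \<open>open S\<close> that]) (rule Suc.prems(1))
    then show ?thesis by (auto simp: differentiable_def)
  qed
  moreover have "Ck_on k (\<lambda>x. frechet_derivative g (at x) v) S" for v
  proof (rule Suc.IH)
    show "Ck_on k (\<lambda>x. frechet_derivative f (at x) v) S" using Suc.prems by simp
    show "frechet_derivative f (at y) v = frechet_derivative g (at y) v" if "y \<in> S" for y
      using frechet_derivative_cong_open[OF \<open>open S\<close> that, of f g] Suc.prems(1) by metis
  qed
  ultimately show ?case by simp
qed

lemma Ck_on_add:
  assumes "open S" "Ck_on k f S" "Ck_on k g S"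
  shows "Ck_on k (\<lambda>x. f x + g x) S"
  using assms(2,3)
proof (induction k arbitrary: f g)
  case 0
  then show ?case by (simp add: continuous_on_add)
next
  case (Suc k)
  have "Ck_on k (\<lambda>x. frechet_derivative (\<lambda>x. f x + g x) (at x) v) S" for v
  proof (rule Ck_on_cong[OF \<open>open S\<close>])
    show "Ck_on k (\<lambda>x. frechet_derivative f (at x) v + frechet_derivative g (at x) v) S"
      using Suc by simp
    show "frechet_derivative f (at x) v + frechet_derivative g (at x) v
        = frechet_derivative (\<lambda>x. f x + g x) (at x) v" if "x \<in> S" for x
    proof -
      have "f differentiable (at x)" "g differentiable (at x)" using Suc.prems that by auto
      then have "((\<lambda>x. f x + g x) has_derivative
          (\<lambda>v. frechet_derivative f (at x) v + frechet_derivative g (at x) v)) (at x)"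
        unfolding frechet_derivative_works by (rule has_derivative_add)
      from frechet_derivative_at[OF this] show ?thesis by metis
    qed
  qed
  then show ?case using Suc.prems by auto
qed

lemma partial_cong:
  assumes "open S" "p \<in> S" "\<And>q. q \<in> S \<Longrightarrow> u q = v q"
  shows "partial E i u p = partial E i v p"
  using frechet_derivative_cong_open[OF assms] by (simp add: partial_def)

lemma laplace_beltrami_cong:
  assumes "open S" "p \<in> S" "\<And>q. q \<in> S \<Longrightarrow> u q = v q"
  shows "laplace_beltrami E g u p = laplace_beltrami E g v p"
proof -
  have "gradient E g u q = gradient E g v q" if "q \<in> S" for q
  proof -
    have "partial E j u q = partial E j v q" for j
      using \<open>open S\<close> that assms(3) by (rule partial_cong)
    then show ?thesis by (simp add: gradient_def)
  qed
  then show ?thesis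
    unfolding laplace_beltrami_def divergence_def
    by (intro arg_cong2[where f = "(/)"] sum.cong refl partial_cong[OF assms(1,2)]) simp
qed

section \<open>The Laplace-Beltrami operator of the product\<close>

lemma open_hyperbolic_disc: "open hyperbolic_disc"
proof -
  have "hyperbolic_disc = ball 0 1" by (auto simp: hyperbolic_disc_def)
  then show ?thesis using open_ball by metis
qed

lemma open_H2R: "open H2R"
  unfolding H2R_def by (intro open_Times open_hyperbolic_disc open_UNIV)

lemma cnj_hyperbolic_disc: "z \<in> hyperbolic_disc \<Longrightarrow> cnj z \<in> hyperbolic_disc"
  by (simp add: hyperbolic_disc_def)

definition conformal_factor :: "complex \<Rightarrow> real" where
  "conformal_factor z = 4 / (1 - (cmod z)\<^sup>2)\<^sup>2"

lemma conformal_factor_pos: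
  assumes "z \<in> hyperbolic_disc"
  shows "conformal_factor z > 0"
proof -
  have "(cmod z)\<^sup>2 < 1" using assms by (simp add: hyperbolic_disc_def power_less_one_iff abs_square_less_1)
  then show ?thesis by (simp add: conformal_factor_def)
qed

lemma differentiable_conformal_factor:
  assumes "z \<in> hyperbolic_disc"
  shows "conformal_factor differentiable (at z)"
proof -
  have "1 - ((Re z)\<^sup>2 + (Im z)\<^sup>2) \<noteq> 0"
    using conformal_factor_pos[OF assms] by (auto simp: conformal_factor_def cmod_power2)
  moreover have "(Re has_derivative Re) (at z)" "(Im has_derivative Im) (at z)"
    by (auto intro: bounded_linear_imp_has_derivative bounded_linear_Re bounded_linear_Im)
  ultimately have "(\<lambda>z. 4 / (1 - ((Re z)\<^sup>2 + (Im z)\<^sup>2))\<^sup>2) differentiable (at z)"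
    by (intro differentiable_divide differentiable_power differentiable_diff differentiable_add
        differentiable_const) (auto simp: differentiable_def)
  then show ?thesis unfolding conformal_factor_def[abs_def] cmod_power2 .
qed

lemma gram_H2R:
  "gram H2R_frame H2R_metric (z, t) =
     (\<chi> i j. if i = j then (if i = 3 then 1 else conformal_factor z) else 0)"
  by (simp add: vec_eq_iff forall_3 gram_def H2R_frame_def H2R_metric_def product_metric_def
      hyperbolic_metric_def euclidean_metric_def conformal_factor_def cmod_power2)

lemma det_gram_H2R: "det (gram H2R_frame H2R_metric (z, t)) = (conformal_factor z)\<^sup>2"
  unfolding gram_H2R by (simp add: det_3 power2_eq_square)

lemma matrix_inv_eqI:
  assumes "A ** B = mat 1" "B ** A = mat 1"
  shows "matrix_inv A = B"
  unfolding matrix_inv_def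
proof (rule some_equality)
  show "A' = B" if "A ** A' = mat 1 \<and> A' ** A = mat 1" for A'
    by (metis assms that matrix_mul_assoc matrix_mul_lid matrix_mul_rid)
qed (use assms in simp)

lemma matrix_inv_gram_H2R:
  assumes "z \<in> hyperbolic_disc"
  shows "matrix_inv (gram H2R_frame H2R_metric (z, t)) =
     (\<chi> i j. if i = j then (if i = 3 then 1 else inverse (conformal_factor z)) else 0)"
proof (rule matrix_inv_eqI)
  have "conformal_factor z \<noteq> 0" using conformal_factor_pos[OF assms] by simp
  then show "gram H2R_frame H2R_metric (z, t) **
      (\<chi> i j. if i = j then (if i = 3 then 1 else inverse (conformal_factor z)) else 0) = mat 1"
    "(\<chi> i j. if i = j then (if i = 3 then 1 else inverse (conformal_factor z)) else 0) **
      gram H2R_frame H2R_metric (z, t) = mat 1"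
    unfolding gram_H2R
    by (simp_all add: vec_eq_iff forall_3 matrix_matrix_mult_def sum_3 mat_def)
qed

text \<open>The volume density is \<open>\<lambda>\<close>, hence density times gradient has the components \<open>F\<^sub>x\<close>, \<open>F\<^sub>y\<close>, \<open>\<lambda> F\<^sub>t\<close>.
  The first two contain no product to differentiate; for the third the product
  rule needs \<open>F\<^sub>t\<close> to be differentiable, and the derivative of \<open>\<lambda>\<close> in direction \<open>t\<close> vanishes.\<close>

lemma laplace_beltrami_H2R:
  assumes z: "z \<in> hyperbolic_disc"
    and diff: "partial H2R_frame 3 F differentiable (at (z, t))"
  shows "laplace_beltrami H2R_frame H2R_metric F (z, t) =
      (partial H2R_frame 1 (partial H2R_frame 1 F) (z, t)
         + partial H2R_frame 2 (partial H2R_frame 2 F) (z, t)) / of_real (conformal_factor z)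
      + partial H2R_frame 3 (partial H2R_frame 3 F) (z, t)"
proof -
  define X where "X q = gradient H2R_frame H2R_metric F q" for q
  let ?l = "\<lambda>q::complex \<times> real. complex_of_real (conformal_factor (fst q))"
  have zt: "(z, t) \<in> H2R" using z by (simp add: H2R_def)
  have l: "?l (z, t) \<noteq> 0" using conformal_factor_pos[OF z] by simp
  have density: "complex_of_real (sqrt (det (gram H2R_frame H2R_metric q))) = ?l q"
    if "q \<in> H2R" for q
    using that conformal_factor_pos[of "fst q"] by (cases q) (auto simp: det_gram_H2R H2R_def)
  have field: "?l q * X q $ 1 = partial H2R_frame 1 F q"
      "?l q * X q $ 2 = partial H2R_frame 2 F q"
      "?l q * X q $ 3 = ?l q * partial H2R_frame 3 F q" if "q \<in> H2R" for q
    using that conformal_factor_pos[of "fst q"]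
    by (cases q; auto simp: X_def gradient_def matrix_inv_gram_H2R sum_3 H2R_def)+
  note cong = partial_cong[OF open_H2R zt]
  have l3: "partial H2R_frame 3 (\<lambda>q. ?l q * partial H2R_frame 3 F q) (z, t)
      = ?l (z, t) * partial H2R_frame 3 (partial H2R_frame 3 F) (z, t)"
  proof -
    obtain L where L: "(conformal_factor has_derivative L) (at z)"
      using differentiable_conformal_factor[OF z] by (auto simp: differentiable_def)
    have "((\<lambda>q::complex \<times> real. conformal_factor (fst q)) has_derivative (\<lambda>v. L (fst v))) (at (z, t))"
      by (rule has_derivative_compose[OF has_derivative_fst[OF has_derivative_ident]]) (simp add: L)
    then have "(?l has_derivative (\<lambda>v. of_real (L (fst v)))) (at (z, t))"
      by (rule has_derivative_of_real)
    moreover have "(partial H2R_frame 3 F has_derivative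
        frechet_derivative (partial H2R_frame 3 F) (at (z, t))) (at (z, t))"
      using diff by (simp add: frechet_derivative_works)
    ultimately have "((\<lambda>q. ?l q * partial H2R_frame 3 F q) has_derivative
        (\<lambda>v. ?l (z, t) * frechet_derivative (partial H2R_frame 3 F) (at (z, t)) v
          + of_real (L (fst v)) * partial H2R_frame 3 F (z, t))) (at (z, t))"
      by (rule has_derivative_mult)
    \<comment> \<open>The \<open>t\<close>-direction has no component in the disc, so the term with \<open>L\<close> drops out.\<close>
    note product = frechet_derivative_at[OF this, symmetric]
    have fst_frame: "fst (H2R_frame $ 3) = 0" by (simp add: H2R_frame_def)
    have "partial H2R_frame 3 (\<lambda>q. ?l q * partial H2R_frame 3 F q) (z, t)
        = frechet_derivative (\<lambda>q. ?l q * partial H2R_frame 3 F q) (at (z, t)) (H2R_frame $ 3)"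
      by (rule partial_def)
    also have "\<dots> = ?l (z, t)
        * frechet_derivative (partial H2R_frame 3 F) (at (z, t)) (H2R_frame $ 3)"
      unfolding product using linear_0[OF has_derivative_linear[OF L]] by (simp add: fst_frame)
    also have "frechet_derivative (partial H2R_frame 3 F) (at (z, t)) (H2R_frame $ 3)
        = partial H2R_frame 3 (partial H2R_frame 3 F) (z, t)"
      by (rule partial_def[symmetric])
    finally show ?thesis .
  qed
  have "laplace_beltrami H2R_frame H2R_metric F (z, t) =
     (\<Sum>i\<in>UNIV. partial H2R_frame i (\<lambda>q. ?l q * X q $ i) (z, t)) / ?l (z, t)"
    unfolding laplace_beltrami_def divergence_def X_def[symmetric] density[OF zt]
    by (intro arg_cong2[where f = "(/)"] sum.cong refl cong) (simp add: density)
  also have "\<dots> = (partial H2R_frame 1 (partial H2R_frame 1 F) (z, t)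
         + partial H2R_frame 2 (partial H2R_frame 2 F) (z, t)
         + ?l (z, t) * partial H2R_frame 3 (partial H2R_frame 3 F) (z, t)) / ?l (z, t)"
    unfolding sum_3 l3[symmetric]
    by (intro arg_cong2[where f = "(/)"] arg_cong2[where f = "(+)"] refl cong field)
  also have "\<dots> = (partial H2R_frame 1 (partial H2R_frame 1 F) (z, t)
         + partial H2R_frame 2 (partial H2R_frame 2 F) (z, t)) / of_real (conformal_factor z)
      + partial H2R_frame 3 (partial H2R_frame 3 F) (z, t)"
    using l by (simp add: add_divide_distrib)
  finally show ?thesis .
qed

section \<open>Separated functions\<close>

text \<open>The \<open>t\<close>-factor is a polynomial as a formal object, so that its derivatives are again available
  as arguments, through \<^const>\<open>pderiv\<close>.\<close>

definition separated ::
  "(complex \<Rightarrow> complex) \<Rightarrow> (complex \<Rightarrow> complex) \<Rightarrow> real poly \<Rightarrow> complex \<times> real \<Rightarrow> complex" where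
  "separated f g q = (\<lambda>(z, t). (f z + g (cnj z)) * of_real (poly q t))"

context
  fixes f g :: "complex \<Rightarrow> complex"
  assumes f: "f holomorphic_on hyperbolic_disc" and g: "g holomorphic_on hyperbolic_disc"
begin

text \<open>The derivative is written so that each summand is again separated, for a fixed direction \<open>v\<close>. The
  conjugate of \<open>fst v\<close> comes from the chain rule through \<^const>\<open>cnj\<close>.\<close>

lemma has_derivative_separated:
  assumes z: "z \<in> hyperbolic_disc"
  shows "(separated f g q has_derivative
     (\<lambda>v. separated (\<lambda>z. fst v * deriv f z) (\<lambda>z. cnj (fst v) * deriv g z) q (z, t)
        + separated f g (smult (snd v) (pderiv q)) (z, t))) (at (z, t))"
proof -
  have "(f has_field_derivative deriv f z) (at z)"
    using holomorphic_derivI[OF f open_hyperbolic_disc z] .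
  then have df: "((\<lambda>p::complex \<times> real. f (fst p)) has_derivative (\<lambda>v. deriv f z * fst v)) (at (z, t))"
    unfolding has_field_derivative_def
    by (intro has_derivative_compose[OF has_derivative_fst[OF has_derivative_ident]]) simp
  have "(g has_field_derivative deriv g (cnj z)) (at (cnj z))"
    using holomorphic_derivI[OF g open_hyperbolic_disc cnj_hyperbolic_disc[OF z]] .
  then have dg: "((\<lambda>p::complex \<times> real. g (cnj (fst p))) has_derivative
      (\<lambda>v. deriv g (cnj z) * cnj (fst v))) (at (z, t))"
    unfolding has_field_derivative_def
    by (intro has_derivative_compose[OF has_derivative_cnj[OF has_derivative_fst[OF has_derivative_ident]]]) simp
  have "(poly q has_field_derivative poly (pderiv q) t) (at t)" by (rule poly_DERIV)
  then have dq: "((\<lambda>p::complex \<times> real. complex_of_real (poly q (snd p))) has_derivative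
      (\<lambda>v. of_real (poly (pderiv q) t * snd v))) (at (z, t))"
    unfolding has_field_derivative_def
    by (intro has_derivative_of_real has_derivative_compose[OF has_derivative_snd[OF has_derivative_ident]]) simp
  show ?thesis
    using has_derivative_mult[OF has_derivative_add[OF df dg] dq]
    by (simp add: separated_def case_prod_unfold algebra_simps)
qed

lemma differentiable_separated:
  assumes "p \<in> H2R"
  shows "separated f g q differentiable (at p)"
proof -
  obtain z t where p: "p = (z, t)" and z: "z \<in> hyperbolic_disc"
    using assms by (cases p) (auto simp: H2R_def)
  show ?thesis
    unfolding p differentiable_def by (rule exI) (rule has_derivative_separated[OF z])
qed

lemma frechet_derivative_separated:
  assumes "z \<in> hyperbolic_disc"
  shows "frechet_derivative (separated f g q) (at (z, t)) v =
     separated (\<lambda>z. fst v * deriv f z) (\<lambda>z. cnj (fst v) * deriv g z) q (z, t)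
        + separated f g (smult (snd v) (pderiv q)) (z, t)"
  by (rule fun_cong[OF frechet_derivative_at[OF has_derivative_separated[OF assms]], symmetric])

end

lemma holomorphic_cmult_deriv:
  "f holomorphic_on hyperbolic_disc \<Longrightarrow> (\<lambda>z. c * deriv f z) holomorphic_on hyperbolic_disc"
  by (intro holomorphic_intros holomorphic_deriv open_hyperbolic_disc)

lemma Ck_on_separated:
  assumes "f holomorphic_on hyperbolic_disc" "g holomorphic_on hyperbolic_disc"
  shows "Ck_on k (separated f g q) H2R"
  using assms
proof (induction k arbitrary: f g q)
  case 0
  have "isCont (separated f g q) p" if "p \<in> H2R" for p
    using differentiable_separated[OF 0 that] by (rule differentiable_imp_continuous_within)
  then show ?case by (simp add: continuous_at_imp_continuous_on)
next
  case (Suc k)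
  have "separated f g q differentiable (at p)" if "p \<in> H2R" for p
    using differentiable_separated[OF Suc.prems that] .
  moreover have "Ck_on k (\<lambda>p. frechet_derivative (separated f g q) (at p) v) H2R" for v
  proof (rule Ck_on_cong[OF open_H2R])
    show "Ck_on k (\<lambda>p. separated (\<lambda>z. fst v * deriv f z) (\<lambda>z. cnj (fst v) * deriv g z) q p
        + separated f g (smult (snd v) (pderiv q)) p) H2R"
      by (intro Ck_on_add open_H2R Suc.IH holomorphic_cmult_deriv Suc.prems)
  qed (auto simp: H2R_def frechet_derivative_separated[OF Suc.prems])
  ultimately show ?case by simp
qed

lemma partial_separated:
  assumes f: "f holomorphic_on hyperbolic_disc" and g: "g holomorphic_on hyperbolic_disc"
    and p: "p \<in> H2R"
  shows "partial H2R_frame 1 (separated f g q) p = separated (deriv f) (deriv g) q p"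
    and "partial H2R_frame 2 (separated f g q) p
      = separated (\<lambda>z. \<i> * deriv f z) (\<lambda>z. - \<i> * deriv g z) q p"
    and "partial H2R_frame 3 (separated f g q) p = separated f g (pderiv q) p"
proof -
  obtain z t where p_eq: "p = (z, t)" and z: "z \<in> hyperbolic_disc"
    using p by (cases p) (auto simp: H2R_def)
  have *: "partial H2R_frame i (separated f g q) p =
      separated (\<lambda>z. fst (H2R_frame $ i) * deriv f z)
        (\<lambda>z. cnj (fst (H2R_frame $ i)) * deriv g z) q (z, t)
      + separated f g (smult (snd (H2R_frame $ i)) (pderiv q)) (z, t)" for i
    unfolding p_eq partial_def by (rule frechet_derivative_separated[OF f g z])
  show "partial H2R_frame 1 (separated f g q) p = separated (deriv f) (deriv g) q p"
    unfolding * by (simp add: p_eq H2R_frame_def separated_def)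
  show "partial H2R_frame 2 (separated f g q) p
      = separated (\<lambda>z. \<i> * deriv f z) (\<lambda>z. - \<i> * deriv g z) q p"
    unfolding * by (simp add: p_eq H2R_frame_def separated_def)
  show "partial H2R_frame 3 (separated f g q) p = separated f g (pderiv q) p"
    unfolding * by (simp add: p_eq H2R_frame_def separated_def)
qed

text \<open>By the Cauchy-Riemann equations \<open>\<partial>/\<partial>y\<close> acts as \<open>\<i> d/dz\<close> on \<open>f\<close> and as \<open>- \<i> d/dz\<close> on \<open>g\<close>. Both
  factors square to \<open>-1\<close>, so the second \<open>x\<close>- and \<open>y\<close>-derivatives cancel.\<close>

lemma laplace_beltrami_separated:
  assumes f: "f holomorphic_on hyperbolic_disc" and g: "g holomorphic_on hyperbolic_disc"
    and p: "p \<in> H2R"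
  shows "laplace_beltrami H2R_frame H2R_metric (separated f g q) p
    = separated f g (pderiv (pderiv q)) p"
proof -
  obtain z t where p_eq: "p = (z, t)" and z: "z \<in> hyperbolic_disc"
    using p by (cases p) (auto simp: H2R_def)
  note df = holomorphic_deriv[OF f open_hyperbolic_disc]
    and dg = holomorphic_deriv[OF g open_hyperbolic_disc]
  have partial_3: "partial H2R_frame 3 (separated f g q) y = separated f g (pderiv q) y"
    if "y \<in> H2R" for y
    using partial_separated(3)[OF f g that] .
  have diff: "partial H2R_frame 3 (separated f g q) differentiable (at (z, t))"
    unfolding differentiable_def
    by (rule exI, rule has_derivative_transform_within_open[OF has_derivative_separated[OF f g z] open_H2R])
      (use p partial_3 p_eq in auto)
  have "partial H2R_frame 1 (partial H2R_frame 1 (separated f g q)) p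
      = partial H2R_frame 1 (separated (deriv f) (deriv g) q) p"
    using open_H2R p partial_separated(1)[OF f g] by (rule partial_cong)
  also have "\<dots> = separated (deriv (deriv f)) (deriv (deriv g)) q p"
    by (rule partial_separated(1)[OF df dg p])
  finally have second_x: "partial H2R_frame 1 (partial H2R_frame 1 (separated f g q)) p
      = separated (deriv (deriv f)) (deriv (deriv g)) q p" .
  have "partial H2R_frame 2 (partial H2R_frame 2 (separated f g q)) p
      = partial H2R_frame 2 (separated (\<lambda>z. \<i> * deriv f z) (\<lambda>z. - \<i> * deriv g z) q) p"
    using open_H2R p partial_separated(2)[OF f g] by (rule partial_cong)
  also have "\<dots> = separated (\<lambda>z. \<i> * deriv (\<lambda>z. \<i> * deriv f z) z)
      (\<lambda>z. - \<i> * deriv (\<lambda>z. - \<i> * deriv g z) z) q p"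
    by (rule partial_separated(2)[OF holomorphic_cmult_deriv[OF f] holomorphic_cmult_deriv[OF g] p])
  also have "\<dots> = - separated (deriv (deriv f)) (deriv (deriv g)) q p"
  proof -
    have "deriv (\<lambda>z. \<i> * deriv f z) z = \<i> * deriv (deriv f) z"
      using holomorphic_on_imp_differentiable_at[OF df open_hyperbolic_disc z]
      by (rule deriv_cmult)
    moreover have "deriv (\<lambda>z. - \<i> * deriv g z) (cnj z) = - \<i> * deriv (deriv g) (cnj z)"
      using holomorphic_on_imp_differentiable_at[OF dg open_hyperbolic_disc cnj_hyperbolic_disc[OF z]]
      by (rule deriv_cmult)
    ultimately show ?thesis
      unfolding separated_def p_eq prod.case by (simp only:) (simp add: algebra_simps)
  qed
  finally have second_y: "partial H2R_frame 2 (partial H2R_frame 2 (separated f g q)) p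
      = - separated (deriv (deriv f)) (deriv (deriv g)) q p" .
  have "partial H2R_frame 3 (partial H2R_frame 3 (separated f g q)) p
      = partial H2R_frame 3 (separated f g (pderiv q)) p"
    using open_H2R p partial_3 by (rule partial_cong)
  also have "\<dots> = separated f g (pderiv (pderiv q)) p"
    by (rule partial_separated(3)[OF f g p])
  finally have second_t: "partial H2R_frame 3 (partial H2R_frame 3 (separated f g q)) p
      = separated f g (pderiv (pderiv q)) p" .
  show ?thesis
    using laplace_beltrami_H2R[OF z diff] second_x second_y second_t by (simp add: p_eq)
qed

theorem corollary7p1:
  fixes f g :: "complex \<Rightarrow> complex" and p :: "real \<Rightarrow> real" and b0 b1 b2 b3 :: real
  assumes f_holomorphic: "f holomorphic_on hyperbolic_disc"
    and g_holomorphic: "g holomorphic_on hyperbolic_disc"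
    and nontrivial: "\<exists>z\<in>hyperbolic_disc. f z + g (cnj z) \<noteq> 0"
    and p_eq: "\<And>t. p t = b0 + b1 * t + b2 * t ^ 2 + b3 * t ^ 3"
    and b_nonzero: "(b2, b3) \<noteq> (0, 0)"
  shows "proper_biharmonic_on H2R_frame H2R_metric H2R
           (\<lambda>(z, t). (f z + g (cnj z)) * complex_of_real (p t))"
proof -
  define q where "q = [:b0, b1, b2, b3:]"
  have F: "(\<lambda>(z, t). (f z + g (cnj z)) * complex_of_real (p t)) = separated f g q"
    by (simp add: separated_def q_def p_eq fun_eq_iff algebra_simps power2_eq_square power3_eq_cube)
  note laplace = laplace_beltrami_separated[OF f_holomorphic g_holomorphic]
  have q'': "pderiv (pderiv q) = [:2 * b2, 6 * b3:]"
    by (simp add: q_def pderiv_pCons)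
  have "smooth_on (separated f g q) H2R"
    using Ck_on_separated[OF f_holomorphic g_holomorphic] by (simp add: smooth_on_def)
  moreover have "laplace_beltrami H2R_frame H2R_metric
      (laplace_beltrami H2R_frame H2R_metric (separated f g q)) x = 0" if "x \<in> H2R" for x
  proof -
    have "laplace_beltrami H2R_frame H2R_metric
        (laplace_beltrami H2R_frame H2R_metric (separated f g q)) x
        = laplace_beltrami H2R_frame H2R_metric (separated f g (pderiv (pderiv q))) x"
      using open_H2R that laplace by (rule laplace_beltrami_cong)
    also have "\<dots> = separated f g (pderiv (pderiv (pderiv (pderiv q)))) x"
      by (rule laplace[OF that])
    finally have "laplace_beltrami H2R_frame H2R_metric
        (laplace_beltrami H2R_frame H2R_metric (separated f g q)) x
        = separated f g (pderiv (pderiv (pderiv (pderiv q)))) x" .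
    then show ?thesis by (simp add: q'' pderiv_pCons separated_def case_prod_unfold)
  qed
  moreover have "\<exists>x\<in>H2R. laplace_beltrami H2R_frame H2R_metric (separated f g q) x \<noteq> 0"
  proof -
    obtain z where z: "z \<in> hyperbolic_disc" "f z + g (cnj z) \<noteq> 0" using nontrivial by blast
    have "pderiv (pderiv q) \<noteq> 0" using b_nonzero by (simp add: q'')
    then obtain t where "poly (pderiv (pderiv q)) t \<noteq> 0" using poly_all_0_iff_0 by blast
    with z have "(z, t) \<in> H2R" "laplace_beltrami H2R_frame H2R_metric (separated f g q) (z, t) \<noteq> 0"
      using laplace[of "(z, t)" q] by (auto simp: H2R_def separated_def)
    then show ?thesis by blast
  qed
  ultimately show ?thesis by (simp add: F proper_biharmonic_on_def)
qed

end
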